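(* Let $\mathbb X$ and $\mathbb A$ be relational structures (over the same signature) such that $\mathrm{Gaif}(\mathbb X)$ is a connected graph, and let $Q:\mathbb X\to_q\mathbb A$ be a contextual quantum homomorphism. Then there exists a bifurcation for $Q$ whose length is at most the diameter of $\mathrm{Gaif}(\mathbb X)$.
   Context: Structures: a signature $\sigma$ is a finite set of relation symbols $R$ with arities $\mathrm{ar}(R)\ge 1$; a $\sigma$-structure $\mathbb A$ consists of a finite domain $A$ and relations $R^{\mathbb A}\subseteq A^{\mathrm{ar}(R)}$ for $R\in\sigma$. All structures are finite. $\mathrm{Gaif}(\mathbb X)$ is the loopless undirected graph on $X$ in which distinct $x,y$ are adjacent iff they occur together in some tuple of some relation of $\mathbb X$. Quantum homomorphisms: a projector on a finite-dimensional Hilbert space $H$ is an operator $p$ with $p=p^*=p^2$. A PVM on $H$ with outcome set $A$ is a family $(Q_a)_{a\in A}$ of projectors with $\sum_a Q_a=\mathrm{id}$. A quantum function $Q$ from $X$ to $A$ is a family of PVMs $(Q_{x,a})_{a\in A}$, one for each $x\in X$, all over the same non-trivial finite-dimensional Hilbert space. It is contextual if $Q_{x,a}Q_{x',a'}\ne Q_{x',a'}Q_{x,a}$ for some $x,x'\in X$, $a,a'\in A$. A quantum homomorphism $Q:\mathbb X\to_q\mathbb A$ between $\sigma$-structures is a quantum function from $X$ to $A$ such that (QH1) $\prod_{i=1}^{\mathrm{ar}(R)}Q_{x_i,a_i}=0$ for all $R\in\sigma$, $\mathbf x\in R^{\mathbb X}$, $\mathbf a\in A^{\mathrm{ar}(R)}\setminus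 R^{\mathbb A}$; (QH2) $Q_{x,a}Q_{x',a'}=Q_{x',a'}Q_{x,a}$ for all $\{x,x'\}\in E(\mathrm{Gaif}(\mathbb X))$ and $a,a'\in A$. Bifurcations: let $\omega$ be a positive integer. A bifurcation of length $\omega$ for $Q:\mathbb X\to_q\mathbb A$ is a 4-tuple $(\mathbf x,\mathbf a,a_0',a_\omega')$ with $\mathbf x=(x_0,\dots,x_\omega)\in X^{\omega+1}$, $\mathbf a=(a_0,\dots,a_\omega)\in A^{\omega+1}$, $a_0',a_\omega'\in A$, such that (i) $x_0,x_1,\dots,x_\omega$ is a walk in $\mathrm{Gaif}(\mathbb X)$; (ii) $a_0\ne a_0'$ and $a_\omega\neq a_\omega'$; (iii) $Q_{x_i,a_i}Q_{x_j,a_j}\ne0$ for all $i<j$ in $\{0,\dots,\omega\}$; (iv) $Q_{x_0,a_0'}Q_{x_j,a_j}\ne0$ for all $j\in\{1,\dots,\omega\}$; (v) $Q_{x_i,a_i}Q_{x_\omega,a_\omega'}\neq0$ for all $i\in\{0,\dots,\omega-1\}$. *)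

theory Defs
  imports Complex_Main "Graph_Theory.Graph_Theory"
begin

section \<open>Finite relational structures\<close>

record 's signature =
  symbols :: "'s set"
  arity :: "'s \<Rightarrow> nat"

definition is_signature :: "'s signature \<Rightarrow> bool" where
  "is_signature \<sigma> \<longleftrightarrow> finite (symbols \<sigma>) \<and> (\<forall>R\<in>symbols \<sigma>. arity \<sigma> R \<ge> 1)"

record ('s, 'a) struct =
  universe :: "'a set"
  rel :: "'s \<Rightarrow> 'a list set"

definition tuples :: "nat \<Rightarrow> 'a set \<Rightarrow> 'a list set" where
  "tuples n A = {t. length t = n \<and> set t \<subseteq> A}"

definition is_structure :: "'s signature \<Rightarrow> ('s, 'a) struct \<Rightarrow> bool" where
  "is_structure \<sigma> \<AA> \<longleftrightarrow>
     finite (universe \<AA>) \<and>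
     (\<forall>R\<in>symbols \<sigma>. rel \<AA> R \<subseteq> tuples (arity \<sigma> R) (universe \<AA>))"

text \<open>An undirected edge is represented by the two opposite arcs.\<close>

definition Gaif :: "'s signature \<Rightarrow> ('s, 'a) struct \<Rightarrow> 'a pair_pre_digraph" where
  "Gaif \<sigma> \<AA> =
     \<lparr> pverts = universe \<AA>,
       parcs = {(x, y). x \<noteq> y \<and> (\<exists>R\<in>symbols \<sigma>. \<exists>t\<in>rel \<AA> R. x \<in> set t \<and> y \<in> set t)} \<rparr>"

lemma pair_graph_Gaif:
  assumes "is_structure \<sigma> \<AA>"
  shows "pair_graph (Gaif \<sigma> \<AA>)"
proof
  show "e \<in> parcs (Gaif \<sigma> \<AA>) \<Longrightarrow> fst e \<in> pverts (Gaif \<sigma> \<AA>)"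
    and "e \<in> parcs (Gaif \<sigma> \<AA>) \<Longrightarrow> snd e \<in> pverts (Gaif \<sigma> \<AA>)" for e
    using assms by (fastforce simp: is_structure_def Gaif_def tuples_def)+
  then have "parcs (Gaif \<sigma> \<AA>) \<subseteq> universe \<AA> \<times> universe \<AA>"
    by (fastforce simp: Gaif_def)
  then show "finite (parcs (Gaif \<sigma> \<AA>))"
    using assms finite_subset by (fastforce simp: is_structure_def)
qed (use assms in \<open>auto simp: is_structure_def Gaif_def symmetric_def sym_def\<close>)

text \<open>With unit weights, \<open>wf_digraph.\<mu> G (\<lambda>_. 1) u v\<close> is the least number of arcs
  of a walk from \<open>u\<close> to \<open>v\<close>, i.e. the graph distance.\<close>

definition diameter :: "('a, 'b) pre_digraph \<Rightarrow> ereal" where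
  "diameter G = (SUP u\<in>verts G. SUP v\<in>verts G. wf_digraph.\<mu> G (\<lambda>_. 1) u v)"

section \<open>Finite-dimensional Hilbert spaces and projectors\<close>

text \<open>The type \<open>'h\<close> is the whole space; completeness is automatic in finite dimension.
  The inner product is linear in the first and conjugate-linear in the second argument.\<close>

locale fin_dim_hilbert_space = vector_space scale
  for scale :: "complex \<Rightarrow> 'h::ab_group_add \<Rightarrow> 'h" +
  fixes cinner :: "'h \<Rightarrow> 'h \<Rightarrow> complex"
  assumes cinner_add_left: "cinner (u + v) w = cinner u w + cinner v w"
    and cinner_scale_left: "cinner (scale c u) v = c * cinner u v"
    and cinner_commute: "cinner u v = cnj (cinner v u)"
    and cinner_pos: "v \<noteq> 0 \<Longrightarrow> Re (cinner v v) > 0"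
    and fin_dim: "\<exists>B. finite B \<and> span B = UNIV"

definition is_adjoint :: "('h \<Rightarrow> 'h \<Rightarrow> complex) \<Rightarrow> ('h \<Rightarrow> 'h) \<Rightarrow> ('h \<Rightarrow> 'h) \<Rightarrow> bool" where
  "is_adjoint cinner p q \<longleftrightarrow> (\<forall>u v. cinner (p u) v = cinner u (q v))"

definition projector ::
  "(complex \<Rightarrow> 'h::ab_group_add \<Rightarrow> 'h) \<Rightarrow> ('h \<Rightarrow> 'h \<Rightarrow> complex) \<Rightarrow> ('h \<Rightarrow> 'h) \<Rightarrow> bool" where
  "projector scale cinner p \<longleftrightarrow>
     Vector_Spaces.linear scale scale p \<and> is_adjoint cinner p p \<and> p \<circ> p = p"

definition PVM ::
  "(complex \<Rightarrow> 'h::ab_group_add \<Rightarrow> 'h) \<Rightarrow> ('h \<Rightarrow> 'h \<Rightarrow> complex) \<Rightarrow>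
    'a set \<Rightarrow> ('a \<Rightarrow> 'h \<Rightarrow> 'h) \<Rightarrow> bool" where
  "PVM scale cinner A P \<longleftrightarrow>
     (\<forall>a\<in>A. projector scale cinner (P a)) \<and> (\<lambda>v. \<Sum>a\<in>A. P a v) = id"

section \<open>Quantum homomorphisms\<close>

definition quantum_function ::
  "(complex \<Rightarrow> 'h::ab_group_add \<Rightarrow> 'h) \<Rightarrow> ('h \<Rightarrow> 'h \<Rightarrow> complex) \<Rightarrow>
    'x set \<Rightarrow> 'a set \<Rightarrow> ('x \<Rightarrow> 'a \<Rightarrow> 'h \<Rightarrow> 'h) \<Rightarrow> bool" where
  "quantum_function scale cinner X A Q \<longleftrightarrow>
     fin_dim_hilbert_space scale cinner \<and> (\<exists>v::'h. v \<noteq> 0) \<and>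
     (\<forall>x\<in>X. PVM scale cinner A (Q x))"

definition contextual ::
  "'x set \<Rightarrow> 'a set \<Rightarrow> ('x \<Rightarrow> 'a \<Rightarrow> 'h \<Rightarrow> 'h) \<Rightarrow> bool" where
  "contextual X A Q \<longleftrightarrow>
     (\<exists>x\<in>X. \<exists>x'\<in>X. \<exists>a\<in>A. \<exists>a'\<in>A. Q x a \<circ> Q x' a' \<noteq> Q x' a' \<circ> Q x a)"

abbreviation zero_op :: "'h \<Rightarrow> 'h::zero" where
  "zero_op \<equiv> (\<lambda>_. 0)"

definition op_prod :: "('h \<Rightarrow> 'h) list \<Rightarrow> 'h \<Rightarrow> 'h" where
  "op_prod ps = foldr (\<circ>) ps id"

definition quantum_hom ::
  "(complex \<Rightarrow> 'h::ab_group_add \<Rightarrow> 'h) \<Rightarrow> ('h \<Rightarrow> 'h \<Rightarrow> complex) \<Rightarrow> 's signature \<Rightarrow>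
    ('s, 'x) struct \<Rightarrow> ('s, 'a) struct \<Rightarrow> ('x \<Rightarrow> 'a \<Rightarrow> 'h \<Rightarrow> 'h) \<Rightarrow> bool" where
  "quantum_hom scale cinner \<sigma> \<XX> \<AA> Q \<longleftrightarrow>
     quantum_function scale cinner (universe \<XX>) (universe \<AA>) Q \<and>
     (\<forall>R\<in>symbols \<sigma>. \<forall>xs\<in>rel \<XX> R. \<forall>as\<in>tuples (arity \<sigma> R) (universe \<AA>) - rel \<AA> R.
        op_prod (map2 Q xs as) = zero_op) \<and>
     (\<forall>(x, x')\<in>parcs (Gaif \<sigma> \<XX>). \<forall>a\<in>universe \<AA>. \<forall>a'\<in>universe \<AA>.
        Q x a \<circ> Q x' a' = Q x' a' \<circ> Q x a)"

definition bifurcation ::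
  "'s signature \<Rightarrow> ('s, 'x) struct \<Rightarrow> ('s, 'a) struct \<Rightarrow> ('x \<Rightarrow> 'a \<Rightarrow> 'h \<Rightarrow> 'h::zero) \<Rightarrow>
    nat \<Rightarrow> 'x list \<times> 'a list \<times> 'a \<times> 'a \<Rightarrow> bool" where
  "bifurcation \<sigma> \<XX> \<AA> Q \<omega> = (\<lambda>(xs, as, a\<^sub>0', a\<^sub>\<omega>').
     \<omega> \<ge> 1 \<and>
     xs \<in> tuples (\<omega> + 1) (universe \<XX>) \<and> as \<in> tuples (\<omega> + 1) (universe \<AA>) \<and>
     a\<^sub>0' \<in> universe \<AA> \<and> a\<^sub>\<omega>' \<in> universe \<AA> \<and>
     vwalk xs (Gaif \<sigma> \<XX>) \<and>
     as ! 0 \<noteq> a\<^sub>0' \<and> as ! \<omega> \<noteq> a\<^sub>\<omega>' \<and>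
     (\<forall>i j. i < j \<and> j \<le> \<omega> \<longrightarrow> Q (xs ! i) (as ! i) \<circ> Q (xs ! j) (as ! j) \<noteq> zero_op) \<and>
     (\<forall>j\<in>{1..\<omega>}. Q (xs ! 0) a\<^sub>0' \<circ> Q (xs ! j) (as ! j) \<noteq> zero_op) \<and>
     (\<forall>i\<in>{0..<\<omega>}. Q (xs ! i) (as ! i) \<circ> Q (xs ! \<omega>) a\<^sub>\<omega>' \<noteq> zero_op))"

end

theory Submission
  imports Defs
begin

text \<open>Take a shortest walk \<open>x\<^sub>0, \<dots>, x\<^sub>\<omega>\<close> whose end measurements do not commute. By minimality all
  other pairs along the walk commute, so the joint outcomes at \<open>x\<^sub>1, \<dots>, x\<^bsub>\<omega>-1\<^esub>\<close> split the space
  into blocks preserved by the measurements at both ends, and on some block \<open>M\<close> two end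
  projectors \<open>P\<close> and \<open>R\<close> do not commute. Hence \<open>M P R\<close>, \<open>M P (1 - R)\<close> and \<open>M (1 - P) R\<close> are
  all non-zero, which provides the two extra outcomes of the bifurcation.\<close>

section \<open>Critical walks\<close>

text \<open>Among all walks whose ends violate \<open>C\<close>, one with the fewest vertices is
  taken. A shorter subwalk violating \<open>C\<close> would contradict this choice. Every walk with
  the same ends is itself a competitor, so the chosen one is a geodesic.\<close>

lemma (in wf_digraph) strongly_connected_critical_walk:
  assumes sc: "strongly_connected G"
    and uv: "u \<in> verts G" "v \<in> verts G" "\<not> C u v"
  obtains xs where "vwalk xs G" "\<not> C (hd xs) (last xs)"
    "\<And>i j. i \<le> j \<Longrightarrow> j < length xs \<Longrightarrow> j - i < vwalk_length xs \<Longrightarrow> C (xs ! i) (xs ! j)"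
    "ereal (real (vwalk_length xs)) \<le> diameter G"
proof -
  let ?bad = "\<lambda>xs. vwalk xs G \<and> \<not> C (hd xs) (last xs)"
  have bad_awalk: "?bad (awalk_verts y p)" if "awalk y p z" "\<not> C y z" for y z p
    using that by (auto simp: awalk_imp_vwalk)
  from sc uv obtain p where "awalk u p v"
    unfolding strongly_connected_def reachable_awalk by blast
  from bad_awalk[OF this uv(3)] obtain xs where xs: "?bad xs"
    and least: "\<And>ys. ?bad ys \<Longrightarrow> length xs \<le> length ys"
    using ex_has_least_nat[of ?bad _ length] by metis
  have ne: "xs \<noteq> []" using xs by auto
  have shorter: "C (xs ! i) (xs ! j)"
    if "i \<le> j" "j < length xs" "j - i < vwalk_length xs" for i j
  proof (rule ccontr)
    assume nC: "\<not> C (xs ! i) (xs ! j)"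
    \<comment> \<open>The stretch from position \<open>i\<close> to position \<open>j\<close> has
      \<open>j - i\<close> arcs, hence \<open>Suc (j - i)\<close> vertices.\<close>
    let ?ys = "take (Suc (j - i)) (drop i xs)"
    have "xs = take i xs @ ?ys @ drop (Suc (j - i)) (drop i xs)" by (simp only: append_take_drop_id)
    moreover have ys: "?ys \<noteq> []" using that by simp
    ultimately have "vwalk ?ys G"
      using xs vwalkI_append_l vwalkI_append_r by (metis append_is_Nil_conv)
    moreover have len: "length ?ys = Suc (j - i)" using that by simp
    moreover have "hd ?ys = xs ! i" "last ?ys = xs ! j"
      using that ys unfolding hd_conv_nth[OF ys] last_conv_nth[OF ys] len by simp_all
    ultimately have "length xs \<le> Suc (j - i)" using least nC by metis
    with that show False by simp
  qed
  have "hd xs \<in> verts G" "last xs \<in> verts G" using xs ne by (auto simp: vwalk_def)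
  then have "\<mu> (\<lambda>_. 1) (hd xs) (last xs) \<le> diameter G"
    unfolding diameter_def by (meson SUP_upper2 order_refl)
  \<comment> \<open>Each walk between these ends competed in the choice of \<open>xs\<close>. Both
    vertex counts exceed the arc counts by one, so the bound carries over to the unit-weight
    cost.\<close>
  moreover have "ereal (real (vwalk_length xs)) \<le> \<mu> (\<lambda>_. 1) (hd xs) (last xs)"
    unfolding \<mu>_def
  proof (rule INF_greatest)
    fix p assume "p \<in> {p. awalk (hd xs) p (last xs)}"
    then have "length xs \<le> length (awalk_verts (hd xs) p)"
      using least bad_awalk xs by simp
    then show "ereal (real (vwalk_length xs)) \<le> ereal (awalk_cost (\<lambda>_. 1) p)"
      by (simp add: length_awalk_verts awalk_cost_def sum_list_triv)
  qed
  ultimately show ?thesis using that xs shorter by (meson order_trans)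
qed

section \<open>Commuting measurements\<close>

definition commuting :: "'a set \<Rightarrow> ('a \<Rightarrow> 'h \<Rightarrow> 'h) \<Rightarrow> ('a \<Rightarrow> 'h \<Rightarrow> 'h) \<Rightarrow> bool" where
  "commuting A P R \<longleftrightarrow> (\<forall>a\<in>A. \<forall>b\<in>A. P a \<circ> R b = R b \<circ> P a)"

lemma commutingD:
  "commuting A P R \<Longrightarrow> a \<in> A \<Longrightarrow> b \<in> A \<Longrightarrow> P a \<circ> R b = R b \<circ> P a"
  by (simp add: commuting_def)

lemma commuting_sym: "commuting A P R \<Longrightarrow> commuting A R P"
  using commutingD[of A P R] by (simp add: commuting_def[of A R P])

lemma is_adjoint_comp:
  "is_adjoint cinner p p' \<Longrightarrow> is_adjoint cinner q q' \<Longrightarrow> is_adjoint cinner (p \<circ> q) (q' \<circ> p')"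
  by (simp add: is_adjoint_def)

text \<open>The values of \<open>F\<close> are fixed points of both factors, so a non-zero one
  survives the product. One non-zero block operator thus settles many conditions of a bifurcation at
  once.\<close>

lemma comp_neq_zero_op:
  assumes "F \<noteq> zero_op" "p \<circ> F = F" "q \<circ> F = F"
  shows "p \<circ> q \<noteq> zero_op"
proof
  assume "p \<circ> q = zero_op"
  moreover have "p \<circ> q \<circ> F = F" using assms(2,3) by (simp add: comp_assoc)
  ultimately show False using assms(1) by (simp add: comp_def)
qed

lemma PVM_self_adjoint: "PVM scale cinner A P \<Longrightarrow> a \<in> A \<Longrightarrow> is_adjoint cinner (P a) (P a)"
  by (simp add: PVM_def projector_def)

lemma PVM_idem: "PVM scale cinner A P \<Longrightarrow> a \<in> A \<Longrightarrow> P a \<circ> P a = P a"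
  by (simp add: PVM_def projector_def)

lemma PVM_sum: "PVM scale cinner A P \<Longrightarrow> (\<Sum>a\<in>A. P a v) = v"
  by (simp add: PVM_def fun_eq_iff)

context fin_dim_hilbert_space
begin

lemma cinner_zero_left: "cinner 0 v = 0"
  using cinner_add_left[of 0 0 v] by simp

lemma cinner_diff_left: "cinner (u - w) v = cinner u v - cinner w v"
  using cinner_add_left[of "u - w" w v] by simp

lemma cinner_sum_left: "cinner (\<Sum>a\<in>A. f a) v = (\<Sum>a\<in>A. cinner (f a) v)"
  by (induction A rule: infinite_finite_induct) (auto simp: cinner_zero_left cinner_add_left)

lemma Re_cinner_self_nonneg: "Re (cinner v v) \<ge> 0"
  using cinner_pos[of v] by (cases "v = 0") (auto simp: cinner_zero_left)

lemma cinner_ext: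
  assumes "\<And>v. cinner u v = cinner w v"
  shows "u = w"
proof (rule ccontr)
  assume "u \<noteq> w"
  with cinner_pos[of "u - w"] have "cinner (u - w) (u - w) \<noteq> 0" by auto
  then show False using assms by (simp add: cinner_diff_left)
qed

lemma is_adjoint_unique:
  "is_adjoint cinner p r \<Longrightarrow> is_adjoint cinner q r \<Longrightarrow> p = q"
  by (intro ext cinner_ext) (simp add: is_adjoint_def)

lemma is_adjoint_zero_op: "is_adjoint cinner zero_op zero_op"
  using cinner_commute[of _ 0] by (simp add: is_adjoint_def cinner_zero_left)

text \<open>Block operators are tracked as self-adjoint maps, without linearity; this is what allows
  one to be cancelled from a non-zero product.\<close>

lemma is_adjoint_zero: "is_adjoint cinner p q \<Longrightarrow> p 0 = 0"
  by (rule cinner_ext) (simp add: is_adjoint_def cinner_zero_left)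

lemma self_adjoint_comp_zero_commute:
  assumes "is_adjoint cinner p p" "is_adjoint cinner q q" "p \<circ> q = zero_op"
  shows "q \<circ> p = zero_op"
proof (rule is_adjoint_unique[OF _ is_adjoint_zero_op])
  show "is_adjoint cinner (q \<circ> p) zero_op"
    using is_adjoint_comp[OF assms(2,1)] assms(3) by simp
qed

text \<open>For \<open>w\<close> in the range of \<open>P b\<close>, the squared norms of all
  \<open>P c w\<close> add up to that of \<open>w\<close>, which the term for \<open>b\<close>
  already exhausts; the other non-negative terms vanish.\<close>

lemma PVM_orthogonal:
  assumes "finite A" "PVM scale cinner A P" "a \<in> A" "b \<in> A" "a \<noteq> b"
  shows "P a \<circ> P b = zero_op"
proof
  fix v
  define w where "w = P b v"
  have Pb: "P b w = w" using PVM_idem[OF assms(2,4)] by (simp add: w_def fun_eq_iff)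
  have norms: "cinner (P c w) w = cinner (P c w) (P c w)" if "c \<in> A" for c
    using PVM_self_adjoint[OF assms(2) that] PVM_idem[OF assms(2) that]
    by (metis comp_apply is_adjoint_def)
  have "cinner w w = (\<Sum>c\<in>A. cinner (P c w) w)"
    using cinner_sum_left[of "\<lambda>c. P c w" A w] PVM_sum[OF assms(2)] by simp
  also have "\<dots> = (\<Sum>c\<in>A. cinner (P c w) (P c w))" by (simp add: norms)
  also have "\<dots> = cinner w w + (\<Sum>c\<in>A - {b}. cinner (P c w) (P c w))"
    using assms(1,4) by (simp add: sum.remove Pb)
  finally have "(\<Sum>c\<in>A - {b}. Re (cinner (P c w) (P c w))) = 0"
    by (simp flip: Re_sum)
  then have "Re (cinner (P a w) (P a w)) = 0"
    using assms by (subst (asm) sum_nonneg_eq_0_iff) (auto simp: Re_cinner_self_nonneg)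
  then show "(P a \<circ> P b) v = 0"
    using cinner_pos[of "P a w"] by (auto simp: w_def)
qed

lemma PVM_commuting_self:
  assumes "finite A" "PVM scale cinner A P"
  shows "commuting A P P"
  unfolding commuting_def
proof (intro ballI)
  fix a b assume "a \<in> A" "b \<in> A"
  then show "P a \<circ> P b = P b \<circ> P a"
    using PVM_orthogonal[OF assms, of a b] PVM_orthogonal[OF assms, of b a] by (cases "a = b") auto
qed

lemma PVM_separates:
  assumes "PVM scale cinner A P" "f \<noteq> g"
  obtains a where "a \<in> A" "P a \<circ> f \<noteq> P a \<circ> g"
proof -
  from assms(2) obtain v where "f v \<noteq> g v" by auto
  then have "(\<Sum>a\<in>A. P a (f v)) \<noteq> (\<Sum>a\<in>A. P a (g v))"
    using PVM_sum[OF assms(1)] by simp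
  then obtain a where "a \<in> A" "P a (f v) \<noteq> P a (g v)" by (meson sum.cong)
  with that show ?thesis by (metis comp_apply)
qed

text \<open>\<open>M\<close> is a product of outcomes, one for each \<open>i\<close>, chosen one
  measurement at a time so that the difference between \<open>f\<close> and \<open>g\<close> stays
  visible. The clause about \<open>S\<close> feeds the induction and later lets measurements outside
  the family pass \<open>M\<close>.\<close>

lemma commuting_PVMs_separate:
  assumes "finite I" "\<And>i. i \<in> I \<Longrightarrow> PVM scale cinner A (E i)"
    and "\<And>i j. i \<in> I \<Longrightarrow> j \<in> I \<Longrightarrow> commuting A (E i) (E j)" "f \<noteq> g"
  obtains M b where "is_adjoint cinner M M" "M \<circ> f \<noteq> M \<circ> g"
    "\<And>i. i \<in> I \<Longrightarrow> b i \<in> A" "\<And>i. i \<in> I \<Longrightarrow> E i (b i) \<circ> M = M"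
    "\<And>S. (\<And>i a. i \<in> I \<Longrightarrow> a \<in> A \<Longrightarrow> S \<circ> E i a = E i a \<circ> S) \<Longrightarrow> S \<circ> M = M \<circ> S"
  using assms
proof (induction I arbitrary: thesis rule: finite_induct)
  case empty
  show ?case
    by (rule empty(1)[of id]) (use empty in \<open>auto simp: is_adjoint_def\<close>)
next
  case (insert k I)
  obtain M b where M: "is_adjoint cinner M M" "M \<circ> f \<noteq> M \<circ> g"
    and b: "\<And>i. i \<in> I \<Longrightarrow> b i \<in> A" "\<And>i. i \<in> I \<Longrightarrow> E i (b i) \<circ> M = M"
    and comm: "\<And>S. (\<And>i a. i \<in> I \<Longrightarrow> a \<in> A \<Longrightarrow> S \<circ> E i a = E i a \<circ> S) \<Longrightarrow> S \<circ> M = M \<circ> S"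
  proof (rule insert.IH, goal_cases)
    case 1
    show ?case by (rule 1(1)[OF 1(2-6)])
  qed (use insert.prems in auto)
  have k: "PVM scale cinner A (E k)" using insert.prems by simp
  obtain a where a: "a \<in> A" "E k a \<circ> (M \<circ> f) \<noteq> E k a \<circ> (M \<circ> g)"
    using PVM_separates[OF k M(2)] .
  \<comment> \<open>This commutation makes the enlarged product self-adjoint and keeps the earlier
    outcomes absorbed.\<close>
  have kM: "E k a \<circ> M = M \<circ> E k a"
    using insert.prems(3) a(1) by (intro comm) (auto dest: commutingD)
  show ?case
  proof (rule insert.prems(1)[of "E k a \<circ> M" "b(k := a)"])
    show "is_adjoint cinner (E k a \<circ> M) (E k a \<circ> M)"
      using is_adjoint_comp[OF PVM_self_adjoint[OF k a(1)] M(1)] kM by simp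
    show "E k a \<circ> M \<circ> f \<noteq> E k a \<circ> M \<circ> g"
      using a(2) by (simp add: comp_assoc)
  next
    fix i assume i: "i \<in> insert k I"
    show "(b(k := a)) i \<in> A" using i a b by auto
    show "E i ((b(k := a)) i) \<circ> (E k a \<circ> M) = E k a \<circ> M"
    proof (cases "i = k")
      case True
      then show ?thesis using PVM_idem[OF k a(1)] by (simp flip: comp_assoc)
    next
      case False
      then show ?thesis using i b kM by (simp flip: comp_assoc)
    qed
  next
    fix S assume S: "\<And>i a. i \<in> insert k I \<Longrightarrow> a \<in> A \<Longrightarrow> S \<circ> E i a = E i a \<circ> S"
    then have "S \<circ> M = M \<circ> S" by (intro comm) auto
    then show "S \<circ> (E k a \<circ> M) = E k a \<circ> M \<circ> S"
      using S[of k a] a(1) by (metis comp_assoc insertI1)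
  qed
qed

text \<open>The adjoint of \<open>M P R\<close> is \<open>M R P\<close>, so every case in which \<open>M P R\<close> degenerates to a
  self-adjoint operator (\<open>0\<close>, or \<open>M P\<close> because the remaining outcomes of \<open>R\<close> vanish) makes
  \<open>P\<close> and \<open>R\<close> commute on the block \<open>M\<close>.\<close>

lemma noncommuting_block_outcome:
  assumes M: "is_adjoint cinner M M" and P: "is_adjoint cinner P P"
    and R: "finite A" "PVM scale cinner A R" "c \<in> A"
    and MP: "P \<circ> M = M \<circ> P" and MR: "\<And>d. d \<in> A \<Longrightarrow> R d \<circ> M = M \<circ> R d"
    and nc: "M \<circ> (P \<circ> R c) \<noteq> M \<circ> (R c \<circ> P)"
  shows "M \<circ> (P \<circ> R c) \<noteq> zero_op"
    and "\<exists>d\<in>A. d \<noteq> c \<and> M \<circ> (R d \<circ> P) \<noteq> zero_op"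
proof -
  have Rc: "is_adjoint cinner (R c) (R c)" using R PVM_self_adjoint by metis
  have "is_adjoint cinner (M \<circ> (P \<circ> R c)) (R c \<circ> P \<circ> M)"
    by (intro is_adjoint_comp M P Rc)
  also have "R c \<circ> P \<circ> M = M \<circ> (R c \<circ> P)"
    using MP MR[OF R(3)] by (metis comp_assoc)
  finally have adj: "is_adjoint cinner (M \<circ> (P \<circ> R c)) (M \<circ> (R c \<circ> P))" .
  \<comment> \<open>\<open>is_adjoint\<close> is one-sided and \<open>is_adjoint_unique\<close>
    compares left arguments, so the opposite direction is derived too.\<close>
  have "is_adjoint cinner (M \<circ> (R c \<circ> P)) (P \<circ> R c \<circ> M)"
    by (intro is_adjoint_comp M P Rc)
  also have "P \<circ> R c \<circ> M = M \<circ> (P \<circ> R c)"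
    using MP MR[OF R(3)] by (metis comp_assoc)
  finally have adj': "is_adjoint cinner (M \<circ> (R c \<circ> P)) (M \<circ> (P \<circ> R c))" .
  show "M \<circ> (P \<circ> R c) \<noteq> zero_op"
    using adj adj' nc is_adjoint_zero_op is_adjoint_unique by metis
  show "\<exists>d\<in>A. d \<noteq> c \<and> M \<circ> (R d \<circ> P) \<noteq> zero_op"
  proof (rule ccontr)
    assume contra: "\<not> ?thesis"
    have "M (P v) = M (R c (P v))" for v
    proof -
      have "R d (M (P v)) = 0" if "d \<in> A" "d \<noteq> c" for d
        using contra that MR[of d] by (metis comp_apply)
      then have "(\<Sum>d\<in>A. R d (M (P v))) = R c (M (P v))"
        using R(1,3) by (simp add: sum.remove)
      then show ?thesis
        using PVM_sum[OF R(2)] MR[OF R(3)] by (metis comp_apply)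
    qed
    then have eq: "M \<circ> (R c \<circ> P) = M \<circ> P" by auto
    have "is_adjoint cinner (M \<circ> P) (M \<circ> P)"
      using is_adjoint_comp[OF M P] MP by simp
    then show False using nc adj eq is_adjoint_unique by metis
  qed
qed

end

section \<open>Bifurcations of minimal length\<close>

theorem theorem8:
  fixes \<sigma> :: "'s signature"
    and \<XX> :: "('s, 'x) struct"
    and \<AA> :: "('s, 'a) struct"
    and scale :: "complex \<Rightarrow> 'h::ab_group_add \<Rightarrow> 'h"
    and cinner :: "'h \<Rightarrow> 'h \<Rightarrow> complex"
    and Q :: "'x \<Rightarrow> 'a \<Rightarrow> 'h \<Rightarrow> 'h"
  assumes "is_signature \<sigma>"
    and "is_structure \<sigma> \<XX>"
    and "is_structure \<sigma> \<AA>"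
    and "Digraph_Component.connected (Gaif \<sigma> \<XX>)"
    and "quantum_hom scale cinner \<sigma> \<XX> \<AA> Q"
    and "contextual (universe \<XX>) (universe \<AA>) Q"
  shows "\<exists>\<omega> b. bifurcation \<sigma> \<XX> \<AA> Q \<omega> b \<and> ereal (real \<omega>) \<le> diameter (Gaif \<sigma> \<XX>)"
proof -
  let ?X = "universe \<XX>" and ?A = "universe \<AA>" and ?G = "Gaif \<sigma> \<XX>"
  interpret G: pair_graph ?G using assms(2) by (rule pair_graph_Gaif)
  have verts: "pverts ?G = ?X" by (simp add: Gaif_def)
  have A: "finite ?A" using assms(3) by (simp add: is_structure_def)
  have hilbert: "fin_dim_hilbert_space scale cinner"
    and PVM: "\<And>x. x \<in> ?X \<Longrightarrow> PVM scale cinner ?A (Q x)"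
    using assms(5) by (auto simp: quantum_hom_def quantum_function_def)
  interpret fin_dim_hilbert_space scale cinner by (rule hilbert)
  let ?C = "\<lambda>x x'. commuting ?A (Q x) (Q x')"
  have "strongly_connected ?G"
    using assms(4) G.sym_arcs by (rule G.symmetric_connected_imp_strongly_connected[rotated])
  moreover from assms(6) obtain u v where "u \<in> pverts ?G" "v \<in> pverts ?G" "\<not> ?C u v"
    unfolding verts by (auto simp: contextual_def commuting_def)
  ultimately obtain xs where xs: "vwalk xs ?G" and nC: "\<not> ?C (hd xs) (last xs)"
    and C: "\<And>i j. i \<le> j \<Longrightarrow> j < length xs \<Longrightarrow> j - i < vwalk_length xs \<Longrightarrow> ?C (xs ! i) (xs ! j)"
    and diam: "ereal (real (vwalk_length xs)) \<le> diameter ?G"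
    by (rule G.strongly_connected_critical_walk[of u v ?C]) blast
  define \<omega> where "\<omega> = vwalk_length xs"
  have ne: "xs \<noteq> []" and X: "set xs \<subseteq> ?X" using xs verts by (simp_all add: vwalk_def)
  then have len: "length xs = \<omega> + 1" by (simp add: \<omega>_def)
  have ends: "hd xs = xs ! 0" "last xs = xs ! \<omega>"
    using ne by (simp_all add: \<omega>_def hd_conv_nth last_conv_nth)
  have PVM': "PVM scale cinner ?A (Q (xs ! i))" if "i \<le> \<omega>" for i
    using that X len by (intro PVM subsetD[OF X] nth_mem) simp
  \<comment> \<open>A one-vertex walk would compare a PVM with itself, and its outcomes
    commute.\<close>
  have "\<omega> \<noteq> 0"
    using nC ends PVM_commuting_self[OF A PVM'[of 0]] by (metis le0)
  then have \<omega>: "\<omega> \<ge> 1" by simp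
  \<comment> \<open>With truncated subtraction, the last two premises exclude exactly the pair of
    the two ends, in either order.\<close>
  have C': "?C (xs ! i) (xs ! j)" if "i \<le> \<omega>" "j \<le> \<omega>" "j - i < \<omega>" "i - j < \<omega>" for i j
  proof (cases "i \<le> j")
    case True
    with that len show ?thesis by (intro C) (auto simp flip: \<omega>_def)
  next
    case False
    with that len show ?thesis by (intro commuting_sym[OF C]) (auto simp flip: \<omega>_def)
  qed
  from nC obtain a c where ac: "a \<in> ?A" "c \<in> ?A"
    and nc: "Q (xs ! 0) a \<circ> Q (xs ! \<omega>) c \<noteq> Q (xs ! \<omega>) c \<circ> Q (xs ! 0) a"
    by (auto simp: commuting_def ends)
  let ?P = "Q (xs ! 0)" and ?R = "Q (xs ! \<omega>)" and ?I = "{1..<\<omega>}"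
  \<comment> \<open>Outcomes at the interior positions (none if \<omega> = 1) are fixed so that the
    non-commutation of \<open>?P a\<close> and \<open>?R c\<close> is still seen after
    \<open>M\<close>.\<close>
  obtain M b where M: "is_adjoint cinner M M"
    and ncM: "M \<circ> (?P a \<circ> ?R c) \<noteq> M \<circ> (?R c \<circ> ?P a)"
    and b: "\<And>i. i \<in> ?I \<Longrightarrow> b i \<in> ?A" "\<And>i. i \<in> ?I \<Longrightarrow> Q (xs ! i) (b i) \<circ> M = M"
    and comm: "\<And>S. (\<And>i d. i \<in> ?I \<Longrightarrow> d \<in> ?A \<Longrightarrow> S \<circ> Q (xs ! i) d = Q (xs ! i) d \<circ> S) \<Longrightarrow> S \<circ> M = M \<circ> S"
  proof (rule commuting_PVMs_separate[of ?I ?A "\<lambda>i. Q (xs ! i)", OF _ _ _ nc])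
    show "PVM scale cinner ?A (Q (xs ! i))" if "i \<in> ?I" for i using PVM' that by simp
    show "?C (xs ! i) (xs ! j)" if "i \<in> ?I" "j \<in> ?I" for i j using that by (intro C') auto
  qed auto
  \<comment> \<open>Each end is fewer than \<omega> steps from every interior position, so its
    measurement commutes with the interior ones and hence with \<open>M\<close>.\<close>
  have MP: "?P d \<circ> M = M \<circ> ?P d" if "d \<in> ?A" for d
    using that by (intro comm commutingD[OF C']) auto
  have MR: "?R d \<circ> M = M \<circ> ?R d" if "d \<in> ?A" for d
    using that by (intro comm commutingD[OF C']) auto
  note P = PVM'[of 0, simplified] and R = PVM'[of \<omega>, simplified]
  have saP: "is_adjoint cinner (?P d) (?P d)" if "d \<in> ?A" for d
    using PVM_self_adjoint[OF P that] .
  have saR: "is_adjoint cinner (?R d) (?R d)" if "d \<in> ?A" for d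
    using PVM_self_adjoint[OF R that] .
  \<comment> \<open>The block lemma is used once per end, with the roles of \<open>?P a\<close> and
    \<open>?R c\<close> exchanged; this supplies a second outcome at each end.\<close>
  note outcomeR = noncommuting_block_outcome
    [where P = "?P a" and R = ?R, OF M saP[OF ac(1)] A R ac(2) MP[OF ac(1)] MR ncM]
  note outcomeP = noncommuting_block_outcome
    [where P = "?R c" and R = ?P, OF M saR[OF ac(2)] A P ac(1) MR[OF ac(2)] MP ncM[symmetric]]
  have F1: "M \<circ> (?P a \<circ> ?R c) \<noteq> zero_op" and F2: "M \<circ> (?R c \<circ> ?P a) \<noteq> zero_op"
    using outcomeR(1) outcomeP(1) by blast+
  obtain c' where c': "c' \<in> ?A" "c' \<noteq> c" and F3: "M \<circ> (?R c' \<circ> ?P a) \<noteq> zero_op"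
    using outcomeR(2) by blast
  obtain a' where a': "a' \<in> ?A" "a' \<noteq> a" and F4: "M \<circ> (?P a' \<circ> ?R c) \<noteq> zero_op"
    using outcomeP(2) by blast
  \<comment> \<open>Interior outcomes fix the values of \<open>M\<close>, and an end outcome passes
    through \<open>M\<close> to merge with its own copy. So \<open>F1\<close> to \<open>F4\<close>
    are each absorbed by the interior outcomes and by their leading end outcome.\<close>
  have absorbI: "Q (xs ! i) (b i) \<circ> (M \<circ> F) = M \<circ> F" if "i \<in> ?I" for i F
    using b(2)[OF that] by (simp flip: comp_assoc)
  have absorbP: "?P d \<circ> (M \<circ> (?P d \<circ> F)) = M \<circ> (?P d \<circ> F)" if "d \<in> ?A" for d F
    using MP[OF that] PVM_idem[OF P that] by (metis comp_assoc)
  have absorbR: "?R d \<circ> (M \<circ> (?R d \<circ> F)) = M \<circ> (?R d \<circ> F)" if "d \<in> ?A" for d F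
    using MR[OF that] PVM_idem[OF R that] by (metis comp_assoc)
  have zeroM: "M \<circ> F \<noteq> zero_op \<Longrightarrow> F \<noteq> zero_op" for F
    using is_adjoint_zero[OF M] by auto
  have mid: "Q (xs ! i) (b i) \<circ> Q (xs ! j) (b j) \<noteq> zero_op" if "i \<in> ?I" "j \<in> ?I" for i j
    using comp_neq_zero_op[OF F1] absorbI that by blast
  \<comment> \<open>The leading factor selects the witness: \<open>F1\<close> for \<open>a\<close>,
    \<open>F2\<close> for \<open>c\<close>, \<open>F4\<close> for \<open>a'\<close>,
    \<open>F3\<close> for \<open>c'\<close>.\<close>
  have left: "?P a \<circ> Q (xs ! j) (b j) \<noteq> zero_op" if "j \<in> ?I" for j
    using comp_neq_zero_op[OF F1] absorbI absorbP that ac by blast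
  have right: "Q (xs ! i) (b i) \<circ> ?R c \<noteq> zero_op" if "i \<in> ?I" for i
    using comp_neq_zero_op[OF F2] absorbI absorbR that ac by blast
  have left': "?P a' \<circ> Q (xs ! j) (b j) \<noteq> zero_op" if "j \<in> ?I" for j
    using comp_neq_zero_op[OF F4] absorbI absorbP that a' by blast
  have right': "Q (xs ! i) (b i) \<circ> ?R c' \<noteq> zero_op" if "i \<in> ?I" for i
    using comp_neq_zero_op[OF F3] absorbI absorbR that c' by blast
  \<comment> \<open>For the two ends it suffices to cancel \<open>M\<close>. \<open>F3\<close> has
    its factors in the order \<open>?R c' \<circ> ?P a\<close>, which taking adjoints
    reverses.\<close>
  have ends_ac: "?P a \<circ> ?R c \<noteq> zero_op" "?P a' \<circ> ?R c \<noteq> zero_op" "?P a \<circ> ?R c' \<noteq> zero_op"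
    using zeroM[OF F1] zeroM[OF F4] zeroM[OF F3]
      self_adjoint_comp_zero_commute[OF saP[OF ac(1)] saR[OF c'(1)]] by auto
  \<comment> \<open>The non-commuting outcomes sit at the ends and those of the block between them;
    as \<omega> \<ge> 1, the two end cases do not collide.\<close>
  define \<alpha> where "\<alpha> i = (if i = 0 then a else if i = \<omega> then c else b i)" for i
  define as where "as = map \<alpha> [0..<\<omega> + 1]"
  have \<alpha>: "\<alpha> 0 = a" "\<alpha> \<omega> = c" "\<And>i. i \<in> ?I \<Longrightarrow> \<alpha> i = b i"
    using \<omega> by (auto simp: \<alpha>_def)
  have as: "as ! i = \<alpha> i" if "i \<le> \<omega>" for i
    using that by (simp add: as_def del: upt_Suc)
  have cases: "i = 0 \<or> i = \<omega> \<or> i \<in> ?I" if "i \<le> \<omega>" for i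
    using that by auto
  have "bifurcation \<sigma> \<XX> \<AA> Q \<omega> (xs, as, a', c')"
    unfolding bifurcation_def prod.case
  proof (intro conjI allI impI ballI)
    show "xs \<in> tuples (\<omega> + 1) ?X" using len X by (simp add: tuples_def)
    have "\<alpha> i \<in> ?A" if "i \<le> \<omega>" for i
      using cases[OF that] \<alpha> ac b by auto
    then show "as \<in> tuples (\<omega> + 1) ?A" by (auto simp: tuples_def as_def)
    show "as ! 0 \<noteq> a'" "as ! \<omega> \<noteq> c'" using a' c' by (auto simp: as \<alpha>)
    show "Q (xs ! i) (as ! i) \<circ> Q (xs ! j) (as ! j) \<noteq> zero_op" if "i < j \<and> j \<le> \<omega>" for i j
      using that cases[of i] cases[of j] mid[of i j] left[of j] right[of i] ends_ac
      by (auto simp: as \<alpha>)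
    show "Q (xs ! 0) a' \<circ> Q (xs ! j) (as ! j) \<noteq> zero_op" if "j \<in> {1..\<omega>}" for j
      using that cases[of j] left'[of j] ends_ac by (auto simp: as \<alpha>)
    show "Q (xs ! i) (as ! i) \<circ> Q (xs ! \<omega>) c' \<noteq> zero_op" if "i \<in> {0..<\<omega>}" for i
      using that cases[of i] right'[of i] ends_ac by (auto simp: as \<alpha>)
  qed (use \<omega> a' c' xs in auto)
  then show ?thesis using diam \<omega>_def by blast
qed

end
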